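(* Let $r,s$ be nonzero real numbers with $r+s=1$, and let $X$ and $Y$ be real normed spaces. An even mapping $f : X\to Y$ satisfies $$f(rx+sy)+rs f(x-y)=r f(x)+s f(y)\quad\text{for all } x,y\in X$$ if and only if the asymptotic condition $$\| f(rx+sy)+rs f(x-y)-r f(x)-s f(y)\|\to 0\quad\text{as } \|x\|+\|y\|\to\infty$$ holds true.
   Context: A mapping $f$ is even if $f(-x)=f(x)$ for all $x\in X$. The asymptotic condition means: for every $\varepsilon>0$ there is $R>0$ such that the norm is at most $\varepsilon$ for all $x,y\in X$ with $\|x\|+\|y\|\ge R$.
   Formalization: The space X is assumed to be nonzero: for X = {0} the asymptotic condition is vacuous, and a nonzero constant f satisfies it but not the functional equation. *)

theory Defs
  imports Complex_Main
begin

end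

theory Submission
  imports Defs
begin

text \<open>
  Let \<open>D x y\<close> be the difference of the two sides of the equation at \<open>(x, y)\<close>. Only the implication
  from the asymptotic condition to the equation needs an argument, and it rests on one exact identity.
  Since \<open>r + s = 1\<close>, the substitution \<open>(u + s v, u - r v)\<close> gives
  \<open>D (u + s v) (u - r v) = f u + r s f v - r f (u + s v) - s f (u - r v)\<close>, so that \<open>r s f v\<close> is a
  combination of this defect and the values of \<open>f\<close> at \<open>u\<close>, \<open>u + s v\<close> and \<open>u - r v\<close>, where \<open>u\<close> is
  arbitrary. Rewrite in this way the four values of \<open>f\<close> that make up \<open>D x y\<close>, with
  the base points \<open>r u + s w\<close>, \<open>u - w\<close>, \<open>u\<close> and \<open>w\<close> respectively.
  The remaining values of \<open>f\<close> then regroup into three further defects, and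
  \<open>r s D x y\<close> becomes a linear combination of seven defects at points that depend on the free
  parameters \<open>u\<close> and \<open>w\<close> (\<open>quadratic_defect_identity\<close>). Letting \<open>u\<close> and \<open>w\<close> go to infinity along a
  fixed line, with \<open>r u + s w\<close> and \<open>u - w\<close> going to infinity as well, makes all seven defects tend
  to \<open>0\<close>, while the left-hand side does not depend on \<open>u\<close> and \<open>w\<close>. Hence \<open>D x y = 0\<close>.
\<close>

text \<open>The defect of the equation at \<open>(x, y)\<close>, that is, left-hand side minus right-hand side.\<close>

definition quadratic_defect ::
    "real \<Rightarrow> real \<Rightarrow> ('a::real_vector \<Rightarrow> 'b::real_vector) \<Rightarrow> 'a \<Rightarrow> 'a \<Rightarrow> 'b" where
  "quadratic_defect r s f x y =
     f (r *\<^sub>R x + s *\<^sub>R y) + (r * s) *\<^sub>R f (x - y) - r *\<^sub>R f x - s *\<^sub>R f y"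

lemma quadratic_defect_shift:
  fixes f :: "'a::real_vector \<Rightarrow> 'b::real_vector"
  assumes "r + s = 1"
  shows "quadratic_defect r s f (u + s *\<^sub>R v) (u - r *\<^sub>R v) =
         f u + (r * s) *\<^sub>R f v - r *\<^sub>R f (u + s *\<^sub>R v) - s *\<^sub>R f (u - r *\<^sub>R v)"
proof -
  have "r *\<^sub>R (u + s *\<^sub>R v) + s *\<^sub>R (u - r *\<^sub>R v) = (r + s) *\<^sub>R u"
    by (simp add: algebra_simps)
  moreover have "(u + s *\<^sub>R v) - (u - r *\<^sub>R v) = (r + s) *\<^sub>R v"
    by (simp add: algebra_simps)
  ultimately show ?thesis
    using assms by (simp add: quadratic_defect_def)
qed

lemma quadratic_defect_identity:
  fixes f :: "'a::real_vector \<Rightarrow> 'b::real_vector"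
  assumes "r + s = 1"
  defines "D \<equiv> quadratic_defect r s f"
  shows "(r * s) *\<^sub>R D x y =
      r *\<^sub>R D (u + s *\<^sub>R x) (w + s *\<^sub>R y) + s *\<^sub>R D (u - r *\<^sub>R x) (w - r *\<^sub>R y) - D u w
    + D ((r *\<^sub>R u + s *\<^sub>R w) + s *\<^sub>R (r *\<^sub>R x + s *\<^sub>R y)) ((r *\<^sub>R u + s *\<^sub>R w) - r *\<^sub>R (r *\<^sub>R x + s *\<^sub>R y))
    + (r * s) *\<^sub>R D ((u - w) + s *\<^sub>R (x - y)) ((u - w) - r *\<^sub>R (x - y))
    - r *\<^sub>R D (u + s *\<^sub>R x) (u - r *\<^sub>R x) - s *\<^sub>R D (w + s *\<^sub>R y) (w - r *\<^sub>R y)"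
proof -
  have plus: "D (u + s *\<^sub>R x) (w + s *\<^sub>R y) =
      f ((r *\<^sub>R u + s *\<^sub>R w) + s *\<^sub>R (r *\<^sub>R x + s *\<^sub>R y)) + (r * s) *\<^sub>R f ((u - w) + s *\<^sub>R (x - y))
      - r *\<^sub>R f (u + s *\<^sub>R x) - s *\<^sub>R f (w + s *\<^sub>R y)"
    by (simp add: D_def quadratic_defect_def algebra_simps)
  have minus: "D (u - r *\<^sub>R x) (w - r *\<^sub>R y) =
      f ((r *\<^sub>R u + s *\<^sub>R w) - r *\<^sub>R (r *\<^sub>R x + s *\<^sub>R y)) + (r * s) *\<^sub>R f ((u - w) - r *\<^sub>R (x - y))
      - r *\<^sub>R f (u - r *\<^sub>R x) - s *\<^sub>R f (w - r *\<^sub>R y)"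
    by (simp add: D_def quadratic_defect_def algebra_simps)
  have base: "D u w = f (r *\<^sub>R u + s *\<^sub>R w) + (r * s) *\<^sub>R f (u - w) - r *\<^sub>R f u - s *\<^sub>R f w"
    "D x y = f (r *\<^sub>R x + s *\<^sub>R y) + (r * s) *\<^sub>R f (x - y) - r *\<^sub>R f x - s *\<^sub>R f y"
    by (simp_all add: D_def quadratic_defect_def)
  note shift = quadratic_defect_shift[OF assms(1), of f, folded D_def]
  show ?thesis
    unfolding plus minus base shift by (simp only: algebra_simps scaleR_scaleR)
qed

lemma filterlim_scaleR_add_const_at_infinity:
  fixes e b :: "'a::real_normed_vector"
  assumes "e \<noteq> 0" and "c \<noteq> 0"
  shows "filterlim (\<lambda>t. (c * t) *\<^sub>R e + b) at_infinity at_top"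
proof -
  have "filterlim (\<lambda>t. (\<bar>c\<bar> * norm e) * \<bar>t\<bar>) at_top at_top"
    using assms
    by (intro filterlim_tendsto_pos_mult_at_top[OF tendsto_const])
      (auto simp: filterlim_abs_real)
  then have "filterlim (\<lambda>t. norm ((c * t) *\<^sub>R e)) at_top at_top"
    by (simp add: abs_mult mult_ac)
  then have "filterlim (\<lambda>t. (c * t) *\<^sub>R e) at_infinity at_top"
    by (rule filterlim_norm_at_top_imp_at_infinity)
  then show "filterlim (\<lambda>t. (c * t) *\<^sub>R e + b) at_infinity at_top"
    by (rule tendsto_add_filterlim_at_infinity'[OF _ tendsto_const])
qed

text \<open>The asymptotic condition is used only along families whose first argument escapes to infinity;
  the second argument is then arbitrary.\<close>

lemma tendsto_zero_if_fst_at_infinity: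
  fixes D :: "'a::real_normed_vector \<Rightarrow> 'a \<Rightarrow> 'b::real_normed_vector"
  assumes D: "\<forall>\<epsilon>>0. \<exists>R>0. \<forall>x y. norm x + norm y \<ge> R \<longrightarrow> norm (D x y) \<le> \<epsilon>"
    and g: "filterlim g at_infinity F"
  shows "((\<lambda>t. D (g t) (h t)) \<longlongrightarrow> 0) F"
  unfolding tendsto_iff
proof (intro allI impI)
  fix e :: real
  assume "e > 0"
  then obtain R where R: "\<And>x y. norm x + norm y \<ge> R \<Longrightarrow> norm (D x y) \<le> e / 2"
    using D[rule_format, of "e / 2"] by auto
  have "\<forall>\<^sub>F t in F. norm (g t) \<ge> R"
    using filterlim_at_infinity_imp_norm_at_top[OF g] by (simp add: filterlim_at_top)
  then show "\<forall>\<^sub>F t in F. dist (D (g t) (h t)) 0 < e"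
  proof eventually_elim
    case (elim t)
    then have "norm (D (g t) (h t)) \<le> e / 2"
      by (intro R) (simp add: add_increasing2)
    with \<open>e > 0\<close> show ?case
      by simp
  qed
qed

lemma quadratic_defect_eq_zero_if_tendsto_zero:
  fixes f :: "'a::real_normed_vector \<Rightarrow> 'b::real_normed_vector"
  assumes "r \<noteq> 0" and "s \<noteq> 0" and rs: "r + s = 1" and "(e::'a) \<noteq> 0"
    and lim: "\<forall>\<epsilon>>0. \<exists>R>0. \<forall>x y. norm x + norm y \<ge> R \<longrightarrow> norm (quadratic_defect r s f x y) \<le> \<epsilon>"
  shows "quadratic_defect r s f x y = 0"
proof -
  define D where "D = quadratic_defect r s f"
  \<comment> \<open>With \<open>u = t e\<close> and \<open>w = k t e\<close>, the points \<open>w\<close>, \<open>u - w\<close> and \<open>r u + s w\<close> are multiples of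
    \<open>t e\<close> by \<open>k\<close>, \<open>1 - k\<close> and \<open>r + s k\<close>, which must not vanish.\<close>
  obtain k :: real where k: "k \<noteq> 0" "1 - k \<noteq> 0" "r + s * k \<noteq> 0"
  proof (cases "r = s")
    case True
    then show ?thesis using that[of 2] rs by auto
  next
    case False
    then show ?thesis using that[of "-1"] by auto
  qed
  have null: "((\<lambda>t. D (g t) (h t)) \<longlongrightarrow> 0) at_top"
    if "c \<noteq> 0" "\<And>t. g t = (c * t) *\<^sub>R e + b" for c b and g h :: "real \<Rightarrow> 'a"
    unfolding that(2) D_def
    by (intro tendsto_zero_if_fst_at_infinity[OF lim] filterlim_scaleR_add_const_at_infinity
        \<open>e \<noteq> 0\<close> that(1))
  note identity =
    quadratic_defect_identity[OF rs, of f x y "t *\<^sub>R e" "(k * t) *\<^sub>R e" for t, folded D_def]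
  have "((\<lambda>t::real. (r * s) *\<^sub>R D x y) \<longlongrightarrow>
      r *\<^sub>R 0 + s *\<^sub>R 0 - 0 + 0 + (r * s) *\<^sub>R 0 - r *\<^sub>R 0 - s *\<^sub>R 0) at_top"
  proof (rule tendsto_cong[THEN iffD2, OF always_eventually, OF allI, OF identity],
      intro tendsto_diff tendsto_add tendsto_scaleR[OF tendsto_const])
    have ux: "((\<lambda>t. D (t *\<^sub>R e + s *\<^sub>R x) (h t)) \<longlongrightarrow> 0) at_top" for h
      by (rule null[of 1]) auto
    \<comment> \<open>Two of the seven defects have the first argument \<open>u + s x\<close>.\<close>
    show "((\<lambda>t. D (t *\<^sub>R e + s *\<^sub>R x) ((k * t) *\<^sub>R e + s *\<^sub>R y)) \<longlongrightarrow> 0) at_top"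
      and "((\<lambda>t. D (t *\<^sub>R e + s *\<^sub>R x) (t *\<^sub>R e - r *\<^sub>R x)) \<longlongrightarrow> 0) at_top"
      by (rule ux)+
    show "((\<lambda>t. D (t *\<^sub>R e - r *\<^sub>R x) (h t)) \<longlongrightarrow> 0) at_top" for h
      by (rule null[of 1 _ "- r *\<^sub>R x"]) auto
    show "((\<lambda>t. D (t *\<^sub>R e) (h t)) \<longlongrightarrow> 0) at_top" for h
      by (rule null[of 1 _ 0]) auto
    show "((\<lambda>t. D ((k * t) *\<^sub>R e + s *\<^sub>R y) (h t)) \<longlongrightarrow> 0) at_top" for h
      by (rule null[OF k(1)]) auto
    show "((\<lambda>t. D ((r *\<^sub>R t *\<^sub>R e + s *\<^sub>R (k * t) *\<^sub>R e) + s *\<^sub>R (r *\<^sub>R x + s *\<^sub>R y)) (h t)) \<longlongrightarrow> 0) at_top" for h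
      by (rule null[OF k(3), of _ "s *\<^sub>R (r *\<^sub>R x + s *\<^sub>R y)"]) (simp add: algebra_simps)
    show "((\<lambda>t. D ((t *\<^sub>R e - (k * t) *\<^sub>R e) + s *\<^sub>R (x - y)) (h t)) \<longlongrightarrow> 0) at_top" for h
      by (rule null[OF k(2), of _ "s *\<^sub>R (x - y)"]) (simp add: algebra_simps)
  qed
  then have "(r * s) *\<^sub>R D x y = 0"
    by (simp add: tendsto_const_iff)
  with \<open>r \<noteq> 0\<close> \<open>s \<noteq> 0\<close> show ?thesis
    by (simp add: D_def)
qed

theorem corollary3p5:
  fixes r s :: real
    and f :: "'a::real_normed_vector \<Rightarrow> 'b::real_normed_vector"
  assumes "r \<noteq> 0" and "s \<noteq> 0" and "r + s = 1"
    and nontrivial: "\<exists>x::'a. x \<noteq> 0"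
    and even: "\<forall>x. f (- x) = f x"
  shows "(\<forall>x y. f (r *\<^sub>R x + s *\<^sub>R y) + (r * s) *\<^sub>R f (x - y) = r *\<^sub>R f x + s *\<^sub>R f y)
    \<longleftrightarrow> (\<forall>\<epsilon>>0. \<exists>R>0. \<forall>x y. norm x + norm y \<ge> R \<longrightarrow>
          norm (f (r *\<^sub>R x + s *\<^sub>R y) + (r * s) *\<^sub>R f (x - y) - r *\<^sub>R f x - s *\<^sub>R f y) \<le> \<epsilon>)"
    (is "?equation \<longleftrightarrow> ?asymptotic")
proof
  assume ?equation
  then show ?asymptotic
    by (auto intro: exI[of _ 1])
next
  assume ?asymptotic
  moreover obtain e :: 'a where "e \<noteq> 0"
    using nontrivial by blast
  ultimately have "quadratic_defect r s f x y = 0" for x y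
    using assms(1-3)
    by (intro quadratic_defect_eq_zero_if_tendsto_zero) (simp_all add: quadratic_defect_def)
  then show ?equation
    by (simp add: quadratic_defect_def algebra_simps)
qed

end
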